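(* Let $f(t)=\sum_{m=0}^{\infty}a_m t^m$ be a formal power series with complex coefficients and let $x,y,z$ be indeterminates. Then, as identities of formal power series in $x,y,z$, $$\sum_{n=0}^{\infty}\frac{x^n}{n!}\left\{\sum_{k=0}^n\binom{n}{k}(-1)^k f(y+zk)\right\} = \sum_{m=0}^{\infty}a_m\left\{\sum_{p=0}^m\binom{m}{p}z^p y^{m-p}\varphi_p(-x)\right\},$$ and, in the case $y=0$, $$\sum_{n=0}^{\infty}\frac{x^n}{n!}\left\{\sum_{k=0}^n\binom{n}{k}(-1)^k f(zk)\right\} = \sum_{m=0}^{\infty}a_m\varphi_m(-x)z^m.$$
   Context: $S(m,n)$ denotes the Stirling numbers of the second kind, $S(m,n)=\frac{(-1)^n}{n!}\sum_{k=0}^n\binom{n}{k}(-1)^k k^m$. The exponential polynomials are $\varphi_m(x)=\sum_{n=0}^m S(m,n)x^n$ for $m\ge 0$. *)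

theory Defs
  imports Complex_Main
    "HOL-Combinatorics.Stirling"
    "HOL-Computational_Algebra.Formal_Power_Series"
    "HOL-Computational_Algebra.Polynomial"
begin

lemma Stirling_explicit:
  "of_nat (Stirling m n) =
     (-1) ^ n / fact n * (\<Sum>k=0..n. of_nat (n choose k) * (-1) ^ k * (of_nat k ^ m :: 'a::field_char_0))"
proof -
  define T :: "nat \<Rightarrow> nat \<Rightarrow> 'a" where
    "T = (\<lambda>m n. \<Sum>k\<le>n. of_nat (n choose k) * (-1) ^ k * of_nat k ^ m)"
  have T_Suc: "T (Suc m) (Suc n) = of_nat (Suc n) * (T m (Suc n) - T m n)" for m n
  proof -
    have c: "of_nat k * (of_nat (Suc n choose k) :: 'a) =
        of_nat (Suc n) * (of_nat (Suc n choose k) - of_nat (n choose k))" for k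
    proof (cases k)
      case (Suc j)
      have "of_nat (Suc j * (Suc n choose Suc j)) = (of_nat (Suc n * (n choose j)) :: 'a)"
        by (simp only: Suc_times_binomial_eq mult.commute)
      then show ?thesis using Suc by (simp only: of_nat_mult binomial_Suc_Suc of_nat_add) simp
    qed simp
    have "T (Suc m) (Suc n) =
        (\<Sum>k\<le>Suc n. (of_nat k * of_nat (Suc n choose k)) * ((-1) ^ k * of_nat k ^ m))"
      unfolding T_def by (intro sum.cong) (simp_all only: power_Suc mult_ac)
    also have "\<dots> = of_nat (Suc n) * (T m (Suc n) -
        (\<Sum>k\<le>Suc n. of_nat (n choose k) * (-1) ^ k * of_nat k ^ m))"
      unfolding T_def c sum_subtractf [symmetric] sum_distrib_left
      by (intro sum.cong refl) (simp only: left_diff_distrib right_diff_distrib mult_ac)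
    also have "(\<Sum>k\<le>Suc n. of_nat (n choose k) * (-1) ^ k * of_nat k ^ m) = T m n"
      unfolding T_def by simp
    finally show ?thesis .
  qed
  have "fact n * of_nat (Stirling m n) = (-1) ^ n * T m n"
  proof (induction m arbitrary: n)
    case 0
    then show ?case
      by (cases n) (simp_all add: T_def choose_alternating_sum mult.commute del: sum.atMost_Suc)
  next
    case (Suc m)
    show ?case
    proof (cases n)
      case 0
      then show ?thesis by (simp add: T_def)
    next
      case [simp]: (Suc j)
      have "fact n * of_nat (Stirling (Suc m) n) =
          of_nat (Suc j) * ((fact (Suc j) * of_nat (Stirling m (Suc j))) +
            fact j * (of_nat (Stirling m j) :: 'a))"
        by (simp add: algebra_simps)
      then show ?thesis
        unfolding Suc.IH by (simp add: T_Suc algebra_simps)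
    qed
  qed
  then show ?thesis
    by (simp add: T_def field_simps atMost_atLeast0)
qed

definition exp_poly :: "nat \<Rightarrow> 'a::comm_ring_1 poly" where
  "exp_poly m = (\<Sum>n=0..m. monom (of_nat (Stirling m n)) n)"

text \<open>
  The ring of formal power series in three indeterminates \<open>x\<close>, \<open>y\<close>, \<open>z\<close> over the complex
  numbers is represented by iterated univariate series; the coefficient of
  \<open>x ^ i * y ^ j * z ^ l\<close> in \<open>F\<close> is \<open>F $ i $ j $ l\<close>.
\<close>
type_synonym fps3 = "complex fps fps fps"

definition const3 :: "complex \<Rightarrow> fps3" where
  "const3 c = fps_const (fps_const (fps_const c))"

definition X3 :: fps3 where "X3 = fps_X"
definition Y3 :: fps3 where "Y3 = fps_const fps_X"
definition Z3 :: fps3 where "Z3 = fps_const (fps_const fps_X)"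

context
  includes fps_syntax
begin

text \<open>
  Infinite sums of formal power series are taken coefficientwise. The metric on the library
  type \<open>fps\<close> is not suitable here, since on iterated series it only takes the
  outermost indeterminate into account.
\<close>
definition formal_summable :: "(nat \<Rightarrow> fps3) \<Rightarrow> bool" where
  "formal_summable F \<longleftrightarrow> (\<forall>i j l. finite {n. F n $ i $ j $ l \<noteq> 0})"

definition formal_suminf :: "(nat \<Rightarrow> fps3) \<Rightarrow> fps3" where
  "formal_suminf F =
     Abs_fps (\<lambda>i. Abs_fps (\<lambda>j. Abs_fps (\<lambda>l. \<Sum>n | F n $ i $ j $ l \<noteq> 0. F n $ i $ j $ l)))"

text \<open>Substitution \<open>f(g)\<close>, meaningful if \<open>g\<close> has no constant term.\<close>
definition fps_subst3 :: "complex fps \<Rightarrow> fps3 \<Rightarrow> fps3" where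
  "fps_subst3 f g = formal_suminf (\<lambda>m. const3 (f $ m) * g ^ m)"

lemma formal_summable_subst3:
  assumes g0: "g $ 0 $ 0 $ 0 = 0"
  shows "formal_summable (\<lambda>m. const3 (f $ m) * g ^ m)"
proof -
  have mult3: "(F * G) $ i $ j $ l =
      (\<Sum>i'=0..i. \<Sum>j'=0..j. \<Sum>l'=0..l. F $ i' $ j' $ l' * G $ (i - i') $ (j - j') $ (l - l'))"
    for F G :: fps3 and i j l
    by (simp add: fps_mult_nth fps_sum_nth)
  have pow: "(g ^ m) $ i $ j $ l = 0" if "i + j + l < m" for m i j l
    using that
  proof (induction m arbitrary: i j l)
    case (Suc m)
    have "g $ i' $ j' $ l' * (g ^ m) $ (i - i') $ (j - j') $ (l - l') = 0"
      if "i' \<le> i" "j' \<le> j" "l' \<le> l" for i' j' l'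
    proof (cases "i' = 0 \<and> j' = 0 \<and> l' = 0")
      case False
      then have "(g ^ m) $ (i - i') $ (j - j') $ (l - l') = 0"
        using that Suc.prems by (intro Suc.IH) linarith
      then show ?thesis by simp
    qed (simp add: g0)
    then show ?case
      unfolding power_Suc mult3 by (intro sum.neutral ballI) simp
  qed simp
  have "{m. (const3 (f $ m) * g ^ m) $ i $ j $ l \<noteq> 0} \<subseteq> {..i + j + l}" for i j l
  proof
    fix m assume "m \<in> {m. (const3 (f $ m) * g ^ m) $ i $ j $ l \<noteq> 0}"
    then have "(g ^ m) $ i $ j $ l \<noteq> 0" by (auto simp: const3_def)
    then show "m \<in> {..i + j + l}" using pow[of i j l m] by (metis atMost_iff not_le)
  qed
  then show ?thesis
    unfolding formal_summable_def by (intro allI) (rule finite_subset[OF _ finite_atMost])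
qed

end

end

theory Submission
  imports Defs
begin

text \<open>
  Compare the coefficients of \<open>x ^ i * y ^ j * z ^ l\<close>. On the left only the term \<open>n = i\<close>
  contributes, and the explicit formula for the Stirling numbers evaluates the alternating sum
  over \<open>k\<close>. On the right only the term \<open>m = j + l\<close> contributes. Both coefficients equal
  \<open>(-1) ^ i * S(l,i)\<close> times the coefficient of \<open>y ^ j * z ^ l\<close> in \<open>f(y + z)\<close>.
\<close>

context
  includes fps_syntax
begin

text \<open>These facts collect the numerical factors of a term into a single \<open>const3\<close>,
  which \<open>const3_mult_nth\<close> then pulls out of every coefficient.\<close>

lemma const3_add: "const3 (a + b) = const3 a + const3 b"
  and const3_mult: "const3 (a * b) = const3 a * const3 b"
  and const3_one: "const3 1 = 1"
  and const3_zero: "const3 0 = 0"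
  and const3_uminus: "const3 (- a) = - const3 a"
  by (simp_all add: const3_def)

lemma const3_power: "const3 (a ^ n) = const3 a ^ n"
  by (induction n) (simp_all add: const3_one const3_mult)

lemma const3_of_nat: "const3 (of_nat n) = of_nat n"
  by (induction n) (simp_all add: const3_zero const3_one const3_add)

lemma const3_minus_one_power: "const3 ((- 1) ^ n) = (- 1) ^ n"
  by (simp add: const3_power const3_uminus const3_one)

lemma const3_mult_nth: "(const3 c * F) $ i $ j $ l = c * F $ i $ j $ l"
  by (simp add: const3_def)

lemma X3_power_mult_nth:
  "(X3 ^ n * F) $ i $ j $ l = (if i < n then 0 else F $ (i - n) $ j $ l)"
  by (simp add: X3_def fps_X_power_mult_nth)

lemma monomial3_nth:
  "(const3 c * (X3 ^ a * Y3 ^ b * Z3 ^ d)) $ i $ j $ l = (if i = a \<and> j = b \<and> l = d then c else 0)"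
proof -
  have "Y3 ^ b * Z3 ^ d = fps_const (fps_X ^ b * fps_const (fps_X ^ d))"
    by (simp add: Y3_def Z3_def fps_const_power)
  then show ?thesis
    unfolding const3_mult_nth mult.assoc X3_power_mult_nth
    by (auto simp: fps_X_power_nth fps_X_power_mult_nth)
qed

text \<open>Each coefficient of the infinite sum receives a contribution from at most one index,
  \<open>h i j l\<close>. This settles summability and the value together.\<close>

lemma formal_sum_single:
  assumes "\<And>n i j l. F n $ i $ j $ l = (if n = h i j l then c i j l else 0)"
  shows formal_summable_single: "formal_summable F"
    and formal_suminf_single: "formal_suminf F = Abs_fps (\<lambda>i. Abs_fps (\<lambda>j. Abs_fps (c i j)))"
proof -
  \<comment> \<open>Only an inclusion holds, since the set is empty when
    \<open>c i j l = 0\<close>.\<close>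
  have sub: "{n. F n $ i $ j $ l \<noteq> 0} \<subseteq> {h i j l}" for i j l
    by (auto simp: assms)
  then show "formal_summable F"
    unfolding formal_summable_def by (meson finite.emptyI finite.insertI finite_subset)
  have "(\<Sum>n | F n $ i $ j $ l \<noteq> 0. F n $ i $ j $ l) = c i j l" for i j l
  proof -
    have "(\<Sum>n | F n $ i $ j $ l \<noteq> 0. F n $ i $ j $ l) = (\<Sum>n\<in>{h i j l}. F n $ i $ j $ l)"
      by (rule sum.mono_neutral_left) (use sub in auto)
    then show ?thesis by (simp add: assms)
  qed
  then show "formal_suminf F = Abs_fps (\<lambda>i. Abs_fps (\<lambda>j. Abs_fps (c i j)))"
    by (simp add: formal_suminf_def)
qed

text \<open>The powers of \<open>g\<close> have disjoint supports, as happens for a linear form in y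
  and z, so a coefficient of f(g) involves a single coefficient of f.\<close>

lemma fps_subst3_nth:
  assumes "\<And>m i j l. (g ^ m) $ i $ j $ l = (if m = h i j l then c i j l else 0)"
  shows "fps_subst3 f g $ i $ j $ l = f $ h i j l * c i j l"
proof -
  have "(const3 (f $ m) * g ^ m) $ i $ j $ l = (if m = h i j l then f $ h i j l * c i j l else 0)"
    for m i j l by (simp add: const3_mult_nth assms)
  from formal_suminf_single[of "\<lambda>m. const3 (f $ m) * g ^ m", OF this] show ?thesis
    by (simp add: fps_subst3_def)
qed

lemma binomial_Y3_Z3_power_nth:
  "((Y3 + Z3 * of_nat k) ^ m) $ i $ j $ l =
     (if m = j + l then (if i = 0 then of_nat ((j + l) choose l) * of_nat k ^ l else 0) else 0)"
proof -
  \<comment> \<open>The swap makes \<open>binomial_ring\<close> attach its index p to the power of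
    \<open>Z3\<close>, so that p is the exponent l. The factor \<open>X3 ^ 0\<close> below fits the
    terms to \<open>monomial3_nth\<close>.\<close>
  have "(Y3 + Z3 * of_nat k) ^ m = (Z3 * of_nat k + Y3) ^ m"
    by (simp add: add.commute)
  also have "\<dots> =
      (\<Sum>p\<le>m. const3 (of_nat (m choose p) * of_nat k ^ p) * (X3 ^ 0 * Y3 ^ (m - p) * Z3 ^ p))"
    unfolding binomial_ring
    by (intro sum.cong) (simp_all add: const3_mult const3_power const3_of_nat power_mult_distrib)
  finally have "((Y3 + Z3 * of_nat k) ^ m) $ i $ j $ l =
      (\<Sum>p\<le>m. if l = p then (if i = 0 \<and> j = m - l then of_nat (m choose l) * of_nat k ^ l else 0) else 0)"
    by (simp only: fps_sum_nth monomial3_nth) (rule sum.cong; auto)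
  \<comment> \<open>The range of p retains l \<le> m, so the truncated equation
    \<open>j = m - l\<close> amounts to \<open>m = j + l\<close>.\<close>
  then show ?thesis
    by auto
qed

lemma Z3_power_nth:
  "((Z3 * of_nat k) ^ m) $ i $ j $ l =
     (if m = l then (if i = 0 \<and> j = 0 then of_nat k ^ l else 0) else 0)"
proof -
  have "(Z3 * of_nat k) ^ m = const3 (of_nat k ^ m) * (X3 ^ 0 * Y3 ^ 0 * Z3 ^ m)"
    by (simp add: const3_power const3_of_nat power_mult_distrib mult.commute)
  then show ?thesis
    by (simp only: monomial3_nth) auto
qed

lemma poly_exp_poly_uminus_X3:
  "poly (exp_poly p) (- X3) = (\<Sum>n\<le>p. const3 ((- 1) ^ n * of_nat (Stirling p n)) * X3 ^ n)"
  by (simp add: exp_poly_def poly_sum poly_monom const3_mult const3_of_nat const3_minus_one_power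
      power_minus[of X3] atLeast0AtMost mult_ac)

lemma exp_poly_term_nth:
  "(const3 c * (Y3 ^ b * Z3 ^ d * poly (exp_poly p) (- X3))) $ i $ j $ l =
     (if j = b \<and> l = d then c * ((- 1) ^ i * of_nat (Stirling p i)) else 0)"
proof -
  have "const3 c * (Y3 ^ b * Z3 ^ d * poly (exp_poly p) (- X3)) =
      (\<Sum>n\<le>p. const3 (c * ((- 1) ^ n * of_nat (Stirling p n))) * (X3 ^ n * Y3 ^ b * Z3 ^ d))"
    unfolding poly_exp_poly_uminus_X3 sum_distrib_left const3_mult[of c]
    by (simp only: mult_ac)
  then have "(const3 c * (Y3 ^ b * Z3 ^ d * poly (exp_poly p) (- X3))) $ i $ j $ l =
      (\<Sum>n\<le>p. if i = n then (if j = b \<and> l = d then c * ((- 1) ^ i * of_nat (Stirling p i)) else 0) else 0)"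
    by (simp only: fps_sum_nth monomial3_nth) (rule sum.cong; auto)
  \<comment> \<open>For i > p no index n matches, in agreement with
    \<open>Stirling p i = 0\<close>.\<close>
  then show ?thesis
    by auto
qed

text \<open>The coefficients of \<open>G k\<close> depend on k only through
  \<open>of_nat k ^ l\<close>. The factor \<open>c j l\<close> therefore leaves the alternating sum,
  and what remains is the explicit formula for S(l,i). Keeping \<open>G\<close> abstract serves both
  f(y+zk) and f(zk).\<close>

lemma alternating_term_nth:
  assumes "\<And>k i j l. G k $ i $ j $ l = (if i = 0 then c j l * of_nat k ^ l else 0)"
  shows "(const3 (1 / fact n) * X3 ^ n * (\<Sum>k=0..n. of_nat (n choose k) * (-1) ^ k * G k)) $ i $ j $ l =
     (if n = i then c j l * ((- 1) ^ i * of_nat (Stirling l i)) else 0)"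
proof -
  have "(\<Sum>k=0..n. of_nat (n choose k) * (-1) ^ k * G k) =
      (\<Sum>k=0..n. const3 (of_nat (n choose k) * (-1) ^ k) * G k)"
    by (simp only: const3_mult const3_of_nat const3_minus_one_power)
  then have "(const3 (1 / fact n) * X3 ^ n * (\<Sum>k=0..n. of_nat (n choose k) * (-1) ^ k * G k)) $ i $ j $ l =
     (if n = i then 1 / fact i * (\<Sum>k=0..i. of_nat (i choose k) * (-1) ^ k * (c j l * of_nat k ^ l)) else 0)"
    by (simp only: mult.assoc[of "const3 (1 / fact n)"] const3_mult_nth X3_power_mult_nth
        fps_sum_nth assms) auto
  also have "1 / fact i * (\<Sum>k=0..i. of_nat (i choose k) * (-1) ^ k * (c j l * of_nat k ^ l)) =
      c j l * (1 / fact i * (\<Sum>k=0..i. of_nat (i choose k) * (-1) ^ k * of_nat k ^ l))"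
    by (simp add: sum_distrib_left mult_ac)
  \<comment> \<open>The explicit formula carries the sign \<open>(-1) ^ i\<close> in front;
    multiplying by the same sign cancels it.\<close>
  also have "1 / fact i * (\<Sum>k=0..i. of_nat (i choose k) * (-1) ^ k * of_nat k ^ l) =
      (- 1) ^ i * (of_nat (Stirling l i) :: complex)"
    by (simp add: Stirling_explicit mult.assoc[symmetric] power_mult_distrib[symmetric])
  finally show ?thesis .
qed

theorem theorem1:
  fixes f :: "complex fps"
  shows
    "(let L = (\<lambda>n. const3 (1 / fact n) * X3 ^ n *
                (\<Sum>k=0..n. of_nat (n choose k) * (-1) ^ k * fps_subst3 f (Y3 + Z3 * of_nat k)));
          R = (\<lambda>m. const3 (fps_nth f m) *
                (\<Sum>p=0..m. of_nat (m choose p) * Z3 ^ p * Y3 ^ (m - p) * poly (exp_poly p) (- X3)))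
      in formal_summable L \<and> formal_summable R \<and> formal_suminf L = formal_suminf R) \<and>
     (let L = (\<lambda>n. const3 (1 / fact n) * X3 ^ n *
                (\<Sum>k=0..n. of_nat (n choose k) * (-1) ^ k * fps_subst3 f (Z3 * of_nat k)));
          R = (\<lambda>m. const3 (fps_nth f m) * poly (exp_poly m) (- X3) * Z3 ^ m)
      in formal_summable L \<and> formal_summable R \<and> formal_suminf L = formal_suminf R)"
proof -
  \<comment> \<open>Both families may select different indices, i on the left and
    \<open>h i j l\<close> on the right, but they share the coefficients c, so their sums are the
    same series.\<close>
  have single: "formal_summable L \<and> formal_summable R \<and> formal_suminf L = formal_suminf R"
    if "\<And>n i j l. L n $ i $ j $ l = (if n = i then c i j l else 0)"
      and "\<And>m i j l. R m $ i $ j $ l = (if m = h i j l then c i j l else 0)" for L R c h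
    using formal_sum_single[of L "\<lambda>i j l. i", OF that(1)] formal_sum_single[of R, OF that(2)]
    by simp
  have substYZ: "fps_subst3 f (Y3 + Z3 * of_nat k) $ i $ j $ l =
      (if i = 0 then f $ (j + l) * of_nat ((j + l) choose l) * of_nat k ^ l else 0)" for k i j l
    by (subst fps_subst3_nth[OF binomial_Y3_Z3_power_nth]) simp
  \<comment> \<open>The condition j = 0 sits inside the factor independent of k, the shape that
    \<open>alternating_term_nth\<close> expects.\<close>
  have substZ: "fps_subst3 f (Z3 * of_nat k) $ i $ j $ l =
      (if i = 0 then (if j = 0 then f $ l else 0) * of_nat k ^ l else 0)" for k i j l
    by (subst fps_subst3_nth[OF Z3_power_nth]) simp
  have termYZ: "(const3 (f $ m) *
        (\<Sum>p=0..m. of_nat (m choose p) * Z3 ^ p * Y3 ^ (m - p) * poly (exp_poly p) (- X3))) $ i $ j $ l =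
      (if m = j + l then f $ (j + l) * of_nat ((j + l) choose l) * ((- 1) ^ i * of_nat (Stirling l i))
       else 0)" for m i j l
  proof -
    have "const3 (f $ m) *
        (\<Sum>p=0..m. of_nat (m choose p) * Z3 ^ p * Y3 ^ (m - p) * poly (exp_poly p) (- X3)) =
      (\<Sum>p\<le>m. const3 (f $ m * of_nat (m choose p)) * (Y3 ^ (m - p) * Z3 ^ p * poly (exp_poly p) (- X3)))"
      by (simp only: sum_distrib_left const3_mult const3_of_nat atLeast0AtMost mult_ac)
    \<comment> \<open>The exponent of z forces p = l, and the exponent of y then forces m = j +
      l.\<close>
    then have "(const3 (f $ m) *
        (\<Sum>p=0..m. of_nat (m choose p) * Z3 ^ p * Y3 ^ (m - p) * poly (exp_poly p) (- X3))) $ i $ j $ l =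
      (\<Sum>p\<le>m. if l = p then (if j = m - l then
         f $ m * of_nat (m choose l) * ((- 1) ^ i * of_nat (Stirling l i)) else 0) else 0)"
      by (simp only: fps_sum_nth exp_poly_term_nth) (rule sum.cong; auto)
    then show ?thesis
      by auto
  qed
  have termZ: "(const3 (f $ m) * poly (exp_poly m) (- X3) * Z3 ^ m) $ i $ j $ l =
      (if m = l then (if j = 0 then f $ l else 0) * ((- 1) ^ i * of_nat (Stirling l i)) else 0)"
    for m i j l
  proof -
    \<comment> \<open>The factor \<open>Y3 ^ 0\<close> makes this the case b = 0 of
      \<open>exp_poly_term_nth\<close>.\<close>
    have "const3 (f $ m) * poly (exp_poly m) (- X3) * Z3 ^ m =
        const3 (f $ m) * (Y3 ^ 0 * Z3 ^ m * poly (exp_poly m) (- X3))"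
      by (simp add: mult_ac)
    then show ?thesis
      by (simp only: exp_poly_term_nth) auto
  qed
  show ?thesis
    unfolding Let_def
    by (intro conjI[OF single[OF alternating_term_nth[OF substYZ] termYZ]
          single[OF alternating_term_nth[OF substZ] termZ]])
qed

end

end
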